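(* Let $a\ge b\ge 2$ be integers with $a\equiv b\pmod 2$. Then $$\int_0^\infty\frac{\tanh^a x}{x^b}\,dx=\frac{a\,2^{b-1}}{(b-1)!}\,\mathcal U_h\!\left((-h)^{b-1}g_a(h)\right).$$
   Context: The Mittag--Leffler polynomials $g_n(x)$, $n\ge 0$, are defined by the formal power series identity in $t$ $$\sum_{n=0}^{\infty}g_n(x)t^n=\frac12\left(\frac{1+t}{1-t}\right)^x=\frac12\exp\bigl(2x\operatorname{artanh}t\bigr).$$ Let $\zeta$ be the Riemann zeta function. For odd integers $k\ge 3$ put $$h_k:=(-1)^{(k-1)/2}\,\frac{(k-1)!\,(2^k-1)}{2^{k-1}\pi^{k-1}}\,\zeta(k).$$ $\mathcal U_h$ denotes the linear evaluation map, defined on the real span of the monomials $h^k$ with $k\ge3$ odd ($h$ an indeterminate), given by $\mathcal U_h(h^k)=h_k$. (For $a\equiv b\pmod 2$ and $a\ge b\ge2$, only odd powers $h^k$ with $k\ge 3$ occur in $(-h)^{b-1}g_a(h)$, because every power $x^r$ occurring in $g_a(x)$ has $r\ge1$ and $r\equiv a\pmod 2$.) Explicitly, the right-hand side of the claim means $$\frac{a2^{b-1}}{(b-1)!}(-1)^{b-1}\sum_{1\le r\le a,\ r\equiv a\ (\mathrm{mod}\ 2)}c_{a,r}\,h_{r+b-1},\qquad c_{a,r}=[x^r]g_a(x),$$ where $[x^r]g_a(x)$ is the coefficient of $x^r$ in $g_a(x)$. *)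

theory Defs
  imports "HOL-Analysis.Analysis"
begin

unbundle fps_syntax and no vec_syntax

definition fps_artanh :: "'a::field_char_0 fps" where
  "fps_artanh = Abs_fps (\<lambda>n. if odd n then 1 / of_nat n else 0)"

(* The formal exponential exp(2 x artanh t) is computed in the ring of power series
   in t with coefficients in the polynomials in x. *)

definition exp_series :: "real poly fps" where
  "exp_series = Abs_fps (\<lambda>m. [:1 / fact m:])"

definition two_x_artanh :: "real poly fps" where
  "two_x_artanh = Abs_fps (\<lambda>n. [:0, 2:] * [:fps_artanh $ n:])"

definition mittag_leffler :: "nat \<Rightarrow> real poly" where
  "mittag_leffler n = (fps_const [:1/2:] * (exp_series oo two_x_artanh)) $ n"

(* The Dirichlet series of the Riemann zeta function: meaningful for s > 1 only. *)

definition riemann_zeta :: "real \<Rightarrow> real" where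
  "riemann_zeta s = (\<Sum>n. 1 / real (Suc n) powr s)"

(* Only the values at odd k >= 3 are meaningful. *)

definition umbral_h :: "nat \<Rightarrow> real" where
  "umbral_h k = (-1) ^ ((k - 1) div 2) *
     (fact (k - 1) * (2 ^ k - 1) / (2 ^ (k - 1) * pi ^ (k - 1))) * riemann_zeta (real k)"

definition umbral_domain :: "real poly set" where
  "umbral_domain = {p. \<forall>k. coeff p k \<noteq> 0 \<longrightarrow> odd k \<and> k \<ge> 3}"

(* Polynomials in the indeterminate h; meaningful for p in umbral_domain, the span of the
   h^k with k >= 3 odd. *)

definition umbral_eval :: "real poly \<Rightarrow> real" where
  "umbral_eval p = (\<Sum>k\<le>degree p. coeff p k * umbral_h k)"

lemma umbral_eval_bound:
  assumes "degree p \<le> N"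
  shows "umbral_eval p = (\<Sum>k\<le>N. coeff p k * umbral_h k)"
  unfolding umbral_eval_def using assms
  by (intro sum.mono_neutral_left) (auto simp: coeff_eq_0)

lemma umbral_eval_add: "umbral_eval (p + q) = umbral_eval p + umbral_eval q"
proof -
  let ?N = "max (degree p) (degree q)"
  have "degree (p + q) \<le> ?N" by (simp add: degree_add_le)
  then show ?thesis
    by (simp add: umbral_eval_bound[of _ ?N] sum.distrib ring_distribs)
qed

lemma umbral_eval_smult: "umbral_eval (smult c p) = c * umbral_eval p"
  by (simp add: umbral_eval_bound[of _ "degree p"] degree_smult_le sum_distrib_left mult.assoc)

lemma umbral_eval_monom: "umbral_eval (monom 1 k) = umbral_h k"
proof -
  have "umbral_eval (monom 1 k) = (\<Sum>i\<le>k. if k = i then umbral_h i else 0)"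
    unfolding umbral_eval_bound[OF degree_monom_le] by (rule sum.cong) auto
  then show ?thesis by simp
qed

lemma poly_fps_power_nth:
  fixes B :: "real poly fps"
  shows "poly ((B ^ i) $ n) x = (Abs_fps (\<lambda>n. poly (B $ n) x) ^ i) $ n"
proof (induction i arbitrary: n)
  case 0
  then show ?case by (cases n) auto
next
  case (Suc i)
  then show ?case by (simp add: fps_mult_nth poly_sum)
qed

lemma mittag_leffler_exp:
  "Abs_fps (\<lambda>n. poly (mittag_leffler n) x) =
     fps_const (1/2) * (fps_exp (2 * x) oo fps_artanh)"
proof -
  have C: "Abs_fps (\<lambda>n. poly (two_x_artanh $ n) x) = fps_const (2 * x) * fps_artanh"
    by (rule fps_ext) (simp add: two_x_artanh_def)
  show ?thesis
    by (rule fps_ext)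
      (simp add: mittag_leffler_def fps_compose_nth exp_series_def poly_sum poly_fps_power_nth C
        power_mult_distrib fps_const_power mult.assoc)
qed

lemma two_x_artanh_power_nth:
  "(two_x_artanh ^ i) $ n = monom (2 ^ i * (fps_artanh ^ i) $ n) i"
proof (induction i arbitrary: n)
  case 0
  then show ?case by (cases n) (auto simp: monom_0)
next
  case (Suc i)
  have B: "two_x_artanh $ j = monom (2 * fps_artanh $ j) 1" for j
    by (simp add: two_x_artanh_def monom_altdef)
  show ?case
    by (simp add: fps_mult_nth Suc B mult_monom monom_sum sum_distrib_left mult_ac)
qed

lemma fps_artanh_power_parity:
  "(fps_artanh ^ i) $ n \<noteq> (0 :: 'a::field_char_0) \<Longrightarrow> i mod 2 = n mod 2"
proof (induction i arbitrary: n)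
  case 0
  then have "n = 0" by (metis power_0 fps_one_nth)
  then show ?case by simp
next
  case (Suc i)
  have "(\<Sum>j=0..n. fps_artanh $ j * (fps_artanh ^ i) $ (n - j)) \<noteq> (0::'a)"
    using Suc.prems unfolding power_Suc fps_mult_nth .
  then obtain j where j0: "j \<in> {0..n}"
      and j1: "fps_artanh $ j * (fps_artanh ^ i) $ (n - j) \<noteq> (0::'a)"
    by (rule sum.not_neutral_contains_not_neutral)
  have j: "fps_artanh $ j \<noteq> (0::'a)" "(fps_artanh ^ i) $ (n - j) \<noteq> (0::'a)"
    using j1 by (metis mult_zero_left, metis mult_zero_right)
  have "odd j" using j(1) unfolding fps_artanh_def fps_nth_Abs_fps by presburger
  moreover have "i mod 2 = (n - j) mod 2" by (rule Suc.IH[OF j(2)])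
  moreover obtain m where "n = j + m" using j0 by (auto simp: le_iff_add)
  ultimately show ?case by (auto simp: mod2_eq_if split: if_splits)
qed

lemma coeff_mittag_leffler:
  "coeff (mittag_leffler n) r =
     (if r \<le> n then 2 ^ r / (2 * fact r) * (fps_artanh ^ r) $ n else 0)"
  by (simp add: mittag_leffler_def fps_compose_nth exp_series_def two_x_artanh_power_nth
      coeff_sum coeff_monom if_distrib sum.delta cong: if_cong)

lemma coeff_mittag_leffler_nz:
  assumes "coeff (mittag_leffler n) r \<noteq> 0" "n \<ge> 1"
  shows "1 \<le> r" "r \<le> n" "r mod 2 = n mod 2"
proof -
  have *: "r \<le> n" "(fps_artanh ^ r) $ n \<noteq> (0::real)"
    using assms by (auto simp: coeff_mittag_leffler split: if_splits)
  show "r \<le> n" by fact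
  show "r mod 2 = n mod 2" using *(2) by (rule fps_artanh_power_parity)
  show "1 \<le> r" using * assms(2) by (cases r) auto
qed

lemma umbral_argument_eq:
  "(- [:0, 1:]) ^ m * mittag_leffler a = smult ((-1) ^ m) (monom 1 m * mittag_leffler a)"
proof -
  have "(- [:0, 1:]) ^ m = smult ((-1) ^ m) (monom (1::real) m)"
    by (simp add: monom_altdef power_minus[of "[:0, 1:]"] flip: smult_power)
  then show ?thesis by simp
qed

lemma umbral_argument_in_domain:
  assumes "a \<ge> b" "b \<ge> 2" "a mod 2 = b mod 2"
  shows "(- [:0, 1:]) ^ (b - 1) * mittag_leffler a \<in> umbral_domain"
  unfolding umbral_domain_def umbral_argument_eq
proof (intro CollectI allI impI)
  fix k assume nz: "coeff (smult ((- 1) ^ (b - 1)) (monom 1 (b - 1) * mittag_leffler a)) k \<noteq> 0"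
  have k: "b - 1 \<le> k \<and> coeff (mittag_leffler a) (k - (b - 1)) \<noteq> 0"
  proof (rule ccontr)
    assume "\<not> ?thesis"
    then have "coeff (monom 1 (b - 1) * mittag_leffler a) k = 0"
      unfolding coeff_monom_mult by (cases "b - 1 \<le> k") simp_all
    then show False using nz unfolding coeff_smult by simp
  qed
  obtain c where b: "b = Suc c" using assms(2) by (cases b) auto
  define r where "r = k - c"
  have kr: "k = r + c" and nzr: "coeff (mittag_leffler a) r \<noteq> 0"
    using k by (simp_all add: b r_def)
  have "a \<ge> 1" using assms(1,2) by linarith
  note r = coeff_mittag_leffler_nz[OF nzr this]
  have "r mod 2 = Suc c mod 2" using r(3) assms(3) b by (simp only:)
  then have odd: "odd k" by (simp add: kr mod2_eq_if split: if_splits)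
  then have "k \<noteq> 2" by (metis even_numeral)
  moreover have "k \<ge> 2" using r(1) assms(2) b kr by linarith
  ultimately show "odd k \<and> 3 \<le> k" using odd by linarith
qed

lemma umbral_eval_explicit:
  assumes "a \<ge> 1"
  shows "umbral_eval ((- [:0, 1:]) ^ m * mittag_leffler a) =
    (-1) ^ m * (\<Sum>r | 1 \<le> r \<and> r \<le> a \<and> r mod 2 = a mod 2.
                   coeff (mittag_leffler a) r * umbral_h (r + m))"
proof -
  have "degree (mittag_leffler a) \<le> a"
    by (rule degree_le) (simp add: coeff_mittag_leffler)
  then have "degree (monom 1 m * mittag_leffler a) \<le> a + m"
    using degree_mult_le[of "monom 1 m" "mittag_leffler a"] degree_monom_le[of "1::real" m] by linarith
  then have "umbral_eval (monom 1 m * mittag_leffler a) =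
      (\<Sum>k\<le>a+m. if m \<le> k then coeff (mittag_leffler a) (k - m) * umbral_h k else 0)"
    by (subst umbral_eval_bound) (auto simp: coeff_monom_mult intro!: sum.cong)
  also have "\<dots> = (\<Sum>r | 1 \<le> r \<and> r \<le> a \<and> r mod 2 = a mod 2.
                   coeff (mittag_leffler a) r * umbral_h (r + m))"
    by (rule sum.reindex_bij_witness_not_neutral[symmetric,
          where S' = "{r. 1 \<le> r \<and> r \<le> a \<and> r mod 2 = a mod 2 \<and> coeff (mittag_leffler a) r * umbral_h (r + m) = 0}"
            and T' = "{k. k \<le> a + m \<and> (if m \<le> k then coeff (mittag_leffler a) (k - m) * umbral_h k else 0) = 0}"
            and i = "\<lambda>k. k - m" and j = "\<lambda>r. r + m"])
       (use coeff_mittag_leffler_nz[OF _ assms] in \<open>auto split: if_splits\<close>)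
  finally show ?thesis unfolding umbral_argument_eq umbral_eval_smult by simp
qed

lemma fps_artanh_deriv: "(1 - fps_X ^ 2) * fps_deriv (fps_artanh :: 'a::field_char_0 fps) = 1"
proof (rule fps_ext)
  fix n
  have D: "fps_deriv fps_artanh $ n = (if even n then 1 else (0::'a))" for n
    by (simp add: fps_artanh_def del: of_nat_Suc)
  show "((1 - fps_X ^ 2) * fps_deriv (fps_artanh :: 'a fps)) $ n = 1 $ n"
  proof (cases "n < 2")
    case True
    then have "n = 0 \<or> n = 1" by linarith
    then show ?thesis
      by (auto simp: left_diff_distrib fps_X_power_mult_nth D simp del: fps_deriv_nth)
  next
    case False
    then show ?thesis
      by (simp add: left_diff_distrib fps_X_power_mult_nth D del: fps_deriv_nth)
  qed
qed

(* fps_binomial x is (1 + t)^x, so the product is ((1 + t) / (1 - t))^x. *)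

lemma mittag_leffler_binomial:
  "Abs_fps (\<lambda>n. poly (mittag_leffler n) x) =
     fps_const (1/2) * (fps_binomial x * (fps_binomial (- x) oo (- fps_X)))"
proof -
  define L where "L = fps_exp (2 * x) oo (fps_artanh :: real fps)"
  define P where "P = fps_binomial x"
  define Q where "Q = (fps_binomial (- x) oo (- fps_X))"
  have L': "(1 - fps_X ^ 2) * fps_deriv L = fps_const (2 * x) * L"
  proof -
    have "fps_deriv L = fps_const (2*x) * L * fps_deriv fps_artanh"
      unfolding L_def by (subst fps_compose_deriv) (simp_all add: fps_artanh_def fps_compose_mult_distrib)
    then have "(1 - fps_X ^ 2) * fps_deriv L =
        fps_const (2*x) * L * ((1 - fps_X ^ 2) * fps_deriv fps_artanh)"
      by (simp only: mult_ac)
    then show ?thesis by (simp only: fps_artanh_deriv mult_1_right)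
  qed
  have b: "(1 + fps_X) * fps_deriv (fps_binomial c) = fps_const c * fps_binomial c" for c :: real
    by (simp add: fps_binomial_deriv fps_divide_unit mult.left_commute[of "1 + fps_X"] inverse_mult_eq_1')
  have P': "(1 + fps_X) * fps_deriv P = fps_const x * P"
    unfolding P_def by (rule b)
  have Q': "(1 - fps_X) * fps_deriv Q = fps_const x * Q"
  proof -
    have "((1 + fps_X) * fps_deriv (fps_binomial (-x))) oo (- fps_X) = (fps_const (-x) * fps_binomial (-x)) oo (- fps_X)"
      by (simp only: b)
    then have "(1 - fps_X) * (fps_deriv (fps_binomial (-x)) oo (- fps_X)) = fps_const (-x) * Q"
      by (simp add: fps_compose_mult_distrib fps_compose_add_distrib Q_def)
    moreover have "fps_deriv Q = - (fps_deriv (fps_binomial (-x)) oo (- fps_X))"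
      unfolding Q_def by (subst fps_compose_deriv) simp_all
    ultimately show ?thesis by (simp add: algebra_simps flip: fps_const_neg)
  qed
  define R where "R = P * Q"
  have R': "(1 - fps_X ^ 2) * fps_deriv R = fps_const (2 * x) * R"
  proof -
    have "(1 - fps_X ^ 2) * fps_deriv R =
        (1 - fps_X) * Q * ((1 + fps_X) * fps_deriv P) + (1 + fps_X) * P * ((1 - fps_X) * fps_deriv Q)"
      unfolding R_def fps_deriv_mult by (simp only: power2_eq_square algebra_simps mult_1_right mult_1_left)
    also have "\<dots> = (fps_const x + fps_const x) * R"
      unfolding P' Q' R_def by (simp only: algebra_simps mult_1_right mult_1_left)
    finally show ?thesis by simp
  qed
  have nz: "(1 - fps_X ^ 2 :: real fps) \<noteq> 0"
    using fps_artanh_deriv[where 'a=real] by (metis mult_zero_left zero_neq_one)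
  have R0: "R $ 0 = 1" and L0: "L $ 0 = 1" by (simp_all add: R_def P_def Q_def L_def)
  have "(1 - fps_X ^ 2) * (fps_deriv L * R) = (1 - fps_X ^ 2) * fps_deriv L * R"
    by (simp only: mult.assoc)
  also have "\<dots> = L * (fps_const (2 * x) * R)" unfolding L' by (simp only: mult_ac)
  also have "\<dots> = (1 - fps_X ^ 2) * (L * fps_deriv R)"
    unfolding R'[symmetric] by (simp only: mult_ac)
  finally have "(1 - fps_X ^ 2) * (fps_deriv L * R) = (1 - fps_X ^ 2) * (L * fps_deriv R)" .
  then have LR: "fps_deriv L * R = L * fps_deriv R" by (rule iffD1[OF mult_left_cancel[OF nz]])
  have iR: "inverse R * R = 1" by (rule inverse_mult_eq_1) (simp add: R0)
  have "fps_deriv (L * inverse R) = 0"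
  proof -
    have "fps_deriv (inverse R) = - fps_deriv R * (inverse R * inverse R)"
      using R0 by (simp add: fps_inverse_deriv power2_eq_square)
    then have "fps_deriv (L * inverse R) =
        fps_deriv L * inverse R - L * fps_deriv R * (inverse R * inverse R)"
      by (simp add: mult.assoc)
    also have "L * fps_deriv R * (inverse R * inverse R) =
        fps_deriv L * inverse R * (inverse R * R)"
      unfolding LR[symmetric] by (simp only: mult_ac)
    finally show ?thesis by (simp add: iR)
  qed
  then have "L * inverse R = fps_const ((L * inverse R) $ 0)" by (rule iffD1[OF fps_deriv_eq_0_iff])
  also have "(L * inverse R) $ 0 = 1" by (simp add: R0 L0)
  finally have LiR: "L * inverse R = 1" by simp
  have "L = L * (inverse R * R)" by (simp only: iR mult_1_right)
  also have "\<dots> = (L * inverse R) * R" by (simp only: mult.assoc)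
  finally have "L = R" by (simp only: LiR mult_1_left)
  then show ?thesis unfolding mittag_leffler_exp L_def R_def P_def Q_def by (rule arg_cong)
qed

end

theory Submission
  imports Defs "HOL-Probability.Sinc_Integral"
begin

text \<open>
  Let \<open>D\<close> be differentiation of functions of \<open>x\<close>, and let \<open>h\<close> act as \<open>-D/2\<close>. The recurrence
  \<open>(n + 2) g\<^sub>n\<^sub>+\<^sub>2 = n g\<^sub>n + 2 h g\<^sub>n\<^sub>+\<^sub>1\<close> then says that \<open>D (tanh ^ a)\<close> equals
  \<open>-2 a g\<^sub>a(-D/2) tanh\<close>. Integrating by parts \<open>b - 1\<close> times, the integral of
  \<open>tanh ^ a / x ^ b\<close> becomes \<open>1 / (b - 1)!\<close> times the integral of \<open>D ^ (b - 1) (tanh ^ a) / x\<close>,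
  and so a combination of the integrals of \<open>D ^ (2 j) tanh / x\<close> with \<open>j \<ge> 1\<close>. With
  \<open>c\<^sub>k = \<pi> (k + 1/2)\<close> the partial fractions
  \<open>D ^ (2 j) tanh x = 2 (2 j)! (\<Sum>k. Re ((x + \<i> c\<^sub>k) ^ (- 2 j - 1)))\<close> can be integrated termwise
  against \<open>1 / x\<close>; by scaling, the real part in the \<open>k\<close>-th term contributes \<open>(-1) ^ j \<pi> / 2 \<cdot> c\<^sub>k ^ (- 2 j - 1)\<close>,
  which sums to a multiple of \<open>\<zeta>(2 j + 1)\<close>.
\<close>

subsection \<open>Integrals over the positive half-line\<close>

text \<open>Integrability and value travel together. Lebesgue rather than gauge integrals: the
  termwise integration of the partial fractions rests on absolute integrability. The value is
  converted to a gauge integral only at the end.\<close>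

definition has_half_line_integral :: "(real \<Rightarrow> real) \<Rightarrow> real \<Rightarrow> bool" where
  "has_half_line_integral f I \<longleftrightarrow>
     has_bochner_integral lborel (\<lambda>x. indicator {0<..} x *\<^sub>R f x) I"

lemma has_half_line_integral_iff:
  "has_half_line_integral f I \<longleftrightarrow>
     set_integrable lborel {0<..} f \<and> (LINT x:{0<..}|lborel. f x) = I"
  by (simp add: has_half_line_integral_def has_bochner_integral_iff set_integrable_def
      set_lebesgue_integral_def)

lemma has_half_line_integral_cong:
  assumes "\<And>x. x > 0 \<Longrightarrow> f x = g x"
  shows "has_half_line_integral f I \<longleftrightarrow> has_half_line_integral g I"
  unfolding has_half_line_integral_def
  by (intro has_bochner_integral_cong refl) (use assms in \<open>auto simp: indicator_def\<close>)

lemma has_half_line_integral_add: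
  assumes "has_half_line_integral f I" "has_half_line_integral g J"
  shows "has_half_line_integral (\<lambda>x. f x + g x) (I + J)"
  using has_bochner_integral_add[OF assms[unfolded has_half_line_integral_def]]
  by (simp add: has_half_line_integral_def algebra_simps)

lemma has_half_line_integral_mult:
  assumes "has_half_line_integral f I"
  shows "has_half_line_integral (\<lambda>x. c * f x) (c * I)"
  using has_bochner_integral_mult_right[of c, OF assms[unfolded has_half_line_integral_def]]
  by (simp add: has_half_line_integral_def mult_ac)

lemma has_half_line_integral_sum:
  assumes "\<And>i. i \<in> A \<Longrightarrow> has_half_line_integral (f i) (I i)"
  shows "has_half_line_integral (\<lambda>x. \<Sum>i\<in>A. f i x) (\<Sum>i\<in>A. I i)"
  using has_bochner_integral_sum[OF assms[unfolded has_half_line_integral_def]]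
  by (simp add: has_half_line_integral_def sum_distrib_left)

lemma has_half_line_integral_abs:
  assumes "has_half_line_integral f I"
  obtains N where "has_half_line_integral (\<lambda>x. \<bar>f x\<bar>) N"
  using set_integrable_abs[of lborel "{0<..}" f] assms
  by (auto simp: has_half_line_integral_iff)

lemma has_half_line_integral_scale:
  assumes "has_half_line_integral f I" "c > 0"
  shows "has_half_line_integral (\<lambda>x. f (x / c)) (c * I)"
proof -
  have "has_bochner_integral lborel (\<lambda>x. indicator {0<..} (0 + (1/c) * x) *\<^sub>R f (0 + (1/c) * x)) (I /\<^sub>R \<bar>1/c\<bar>)"
    using lborel_has_bochner_integral_real_affine_iff[of "1/c" "\<lambda>x. indicator {0<..} x *\<^sub>R f x" I 0]
      assms by (simp add: has_half_line_integral_def)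
  moreover have "(\<lambda>x. indicator {0<..} (0 + (1/c) * x) *\<^sub>R f (0 + (1/c) * x)) =
      (\<lambda>x. indicator {0<..} x *\<^sub>R f (x / c))"
    using assms(2) by (auto simp: indicator_def fun_eq_iff zero_less_divide_iff)
  moreover have "I /\<^sub>R \<bar>1/c\<bar> = c * I" using assms(2) by simp
  ultimately show ?thesis unfolding has_half_line_integral_def by (simp only:)
qed

lemma has_half_line_integral_imp_has_integral:
  assumes "has_half_line_integral f I"
  shows "(f has_integral I) {0<..}"
  using assms set_borel_integral_eq_integral[of "{0<..}" f]
  by (auto simp: has_half_line_integral_iff has_integral_iff)

lemma has_half_line_integral_inverse_1_plus_square:
  "has_half_line_integral (\<lambda>x. 1 / (1 + x\<^sup>2)) (pi / 2)"
  using integrable_I0i_1_div_plus_square LBINT_I0i_1_div_plus_square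
  by (simp add: has_half_line_integral_iff interval_lebesgue_integral_0_infty)

text \<open>The majorant is bounded near 0 and integrable at infinity, so a single comparison
  settles both ends.\<close>

lemma set_integrable_half_line_bound:
  fixes f :: "real \<Rightarrow> real"
  assumes "continuous_on {0<..} f" "\<And>x. x > 0 \<Longrightarrow> \<bar>f x\<bar> \<le> C / (1 + x\<^sup>2)"
  shows "set_integrable lborel {0<..} f"
proof (rule set_integrable_bound)
  have "has_half_line_integral (\<lambda>x. C * (1 / (1 + x\<^sup>2))) (C * (pi / 2))"
    by (intro has_half_line_integral_mult has_half_line_integral_inverse_1_plus_square)
  then show "set_integrable lborel {0<..} (\<lambda>x. C * (1 / (1 + x\<^sup>2)))"
    by (simp add: has_half_line_integral_iff)
  show "set_borel_measurable lborel {0<..} f"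
    using set_measurable_continuous_on[of "{0<..}" f] assms(1)
    by (simp add: set_borel_measurable_def)
  show "AE x in lborel. x \<in> {0<..} \<longrightarrow> norm (f x) \<le> norm (C * (1 / (1 + x\<^sup>2)))"
  proof (intro AE_I2 impI)
    fix x :: real assume "x \<in> {0<..}"
    then have "\<bar>f x\<bar> \<le> C / (1 + x\<^sup>2)" using assms(2) by simp
    then show "norm (f x) \<le> norm (C * (1 / (1 + x\<^sup>2)))"
      using abs_ge_self[of "C / (1 + x\<^sup>2)"] by simp
  qed
qed

lemma has_half_line_integral_FTC:
  assumes F: "\<And>x. x > 0 \<Longrightarrow> (F has_real_derivative f x) (at x)"
    and f: "continuous_on {0<..} f" and int: "set_integrable lborel {0<..} f"
    and A: "(F \<longlongrightarrow> A) (at_right 0)" and B: "(F \<longlongrightarrow> B) at_top"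
  shows "has_half_line_integral f (B - A)"
proof -
  have "(LBINT x=0..\<infinity>. f x) = B - A"
  proof (rule interval_integral_FTC_integrable)
    show "(F has_vector_derivative f x) (at x)" if "0 < ereal x" for x
      using F[of x] that by (simp add: has_real_derivative_iff_has_vector_derivative)
    show "isCont f x" if "0 < ereal x" for x
      using f that by (simp add: continuous_on_eq_continuous_at)
    show "set_integrable lborel (einterval 0 \<infinity>) f" using int by (simp add: zero_ereal_def)
    show "((F \<circ> real_of_ereal) \<longlongrightarrow> A) (at_right 0)"
      using A by (simp add: zero_ereal_def ereal_tendsto_simps)
    show "((F \<circ> real_of_ereal) \<longlongrightarrow> B) (at_left \<infinity>)"
      using B by (simp add: ereal_tendsto_simps)
  qed simp
  then show ?thesis using int
    by (simp add: has_half_line_integral_iff interval_lebesgue_integral_0_infty)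
qed

text \<open>Sum and integral are interchanged because the L1 norms \<open>N k\<close> are summable.
  They are kept as explicit data since scaling will produce them in closed form from a single
  norm.\<close>

lemma has_half_line_integral_sums:
  assumes f: "\<And>k. has_half_line_integral (f k) (I k)"
    and N: "\<And>k. has_half_line_integral (\<lambda>x. \<bar>f k x\<bar>) (N k)" "summable N"
    and g: "\<And>x. x > 0 \<Longrightarrow> summable (\<lambda>k. \<bar>f k x\<bar>)" "\<And>x. x > 0 \<Longrightarrow> (\<lambda>k. f k x) sums g x"
    and I: "I sums J"
  shows "has_half_line_integral g J"
proof -
  let ?f = "\<lambda>k x. indicator {0<..} x *\<^sub>R f k x"
  have abs: "\<bar>?f k x\<bar> = indicator {0<..} x *\<^sub>R \<bar>f k x\<bar>" for k x
    by (simp add: indicator_def)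
  have int: "integrable lborel (?f k)" and I_eq: "integral\<^sup>L lborel (?f k) = I k"
    and N_eq: "integral\<^sup>L lborel (\<lambda>x. \<bar>?f k x\<bar>) = N k" for k
    using f N(1) unfolding has_half_line_integral_def has_bochner_integral_iff abs by blast+
  have summable: "AE x in lborel. summable (\<lambda>k. norm (?f k x))"
    using g(1) by (intro AE_I2) (auto simp: indicator_def)
  have "summable (\<lambda>k. integral\<^sup>L lborel (\<lambda>x. norm (?f k x)))"
    using N(2) N_eq by simp
  note * = integrable_suminf[OF int summable this] sums_integral[OF int summable this]
  have eq: "(\<Sum>k. ?f k x) = indicator {0<..} x *\<^sub>R g x" for x
    using g(2) by (auto simp: indicator_def sums_iff)
  show ?thesis
    using * I unfolding eq I_eq has_half_line_integral_def has_bochner_integral_iff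
    by (auto intro: sums_unique2)
qed

subsection \<open>Differentiation of polynomials in tanh\<close>

text \<open>The factor \<open>-1/2\<close> makes \<open>tanh_op\<close> the counterpart of multiplication by the umbral
  variable \<open>h\<close>: both turn the three-term recurrence of the Mittag--Leffler polynomials into the one
  coming from \<open>(tanh ^ n)' = n (tanh ^ (n - 1) - tanh ^ (n + 1))\<close>.\<close>

definition tanh_op :: "real poly \<Rightarrow> real poly" where
  "tanh_op p = smult (-1/2) ((1 - monom 1 2) * pderiv p)"

lemma DERIV_poly_tanh:
  "((\<lambda>x. poly p (tanh x)) has_real_derivative -2 * poly (tanh_op p) (tanh x)) (at x)"
  by (auto intro!: derivative_eq_intros simp: tanh_op_def poly_monom cosh_real_nonzero)

lemma tanh_op_add: "tanh_op (p + q) = tanh_op p + tanh_op q"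
  by (simp add: tanh_op_def pderiv_add ring_distribs smult_add_right)

lemma tanh_op_smult: "tanh_op (smult c p) = smult c (tanh_op p)"
  by (simp add: tanh_op_def pderiv_smult)

lemma tanh_op_sum: "tanh_op (\<Sum>i\<in>A. f i) = (\<Sum>i\<in>A. tanh_op (f i))"
  by (induction A rule: infinite_finite_induct) (simp_all add: tanh_op_add, simp_all add: tanh_op_def)

lemma funpow_tanh_op_smult: "(tanh_op ^^ n) (smult c p) = smult c ((tanh_op ^^ n) p)"
  by (induction n) (simp_all add: tanh_op_smult)

lemma tanh_op_monom: "tanh_op (monom 1 (Suc n)) =
    smult (real (Suc n) / 2) (monom 1 (n + 2) - monom 1 n)"
  by (rule poly_eqI)
     (simp add: tanh_op_def pderiv_monom left_diff_distrib mult_monom algebra_simps diff_divide_distrib)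

text \<open>Differentiation lowers the order of vanishing at 0 by at most one. This order controls
  the boundary terms in the integration by parts.\<close>

lemma monom_dvd_tanh_op:
  assumes "monom 1 (Suc n) dvd p"
  shows "monom 1 n dvd tanh_op p"
proof -
  obtain q where "p = monom 1 (Suc n) * q" using assms by (elim dvdE)
  moreover have "pderiv (monom 1 (Suc n)) = monom 1 n * [:real (Suc n):]"
    by (simp add: pderiv_monom smult_monom)
  moreover have "monom 1 (Suc n) = monom 1 n * monom (1::real) 1" by (simp add: mult_monom)
  ultimately have "monom 1 n dvd pderiv p"
    by (simp add: pderiv_mult del: mult_pCons_right)
  then show ?thesis unfolding tanh_op_def by (intro dvd_smult dvd_mult)
qed

text \<open>Once \<open>i \<ge> a\<close>, truncated subtraction makes the divisor the constant 1,
  so the induction step is only needed for \<open>i < a\<close>.\<close>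

lemma monom_dvd_funpow_tanh_op: "monom 1 (a - i) dvd (tanh_op ^^ i) (monom 1 a)"
proof (induction i)
  case (Suc i)
  then show ?case
  proof (cases "i < a")
    case True
    then have "a - i = Suc (a - Suc i)" by simp
    then show ?thesis using Suc monom_dvd_tanh_op by simp
  qed simp
qed simp

text \<open>This is p(-D/2) tanh, written as a polynomial in t = tanh x: tanh itself is the
  polynomial \<open>monom 1 1\<close>, and the umbral variable acts through
  \<open>tanh_op\<close>.\<close>

definition tanh_umbral :: "real poly \<Rightarrow> real poly" where
  "tanh_umbral p = (\<Sum>r\<le>degree p. smult (coeff p r) ((tanh_op ^^ r) (monom 1 1)))"

lemma tanh_umbral_bound:
  assumes "degree p \<le> N"
  shows "tanh_umbral p = (\<Sum>r\<le>N. smult (coeff p r) ((tanh_op ^^ r) (monom 1 1)))"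
  unfolding tanh_umbral_def using assms
  by (intro sum.mono_neutral_left) (auto simp: coeff_eq_0)

lemma tanh_umbral_add: "tanh_umbral (p + q) = tanh_umbral p + tanh_umbral q"
proof -
  let ?N = "max (degree p) (degree q)"
  have "degree (p + q) \<le> ?N" by (simp add: degree_add_le)
  then show ?thesis
    by (simp add: tanh_umbral_bound[of _ ?N] sum.distrib smult_add_left)
qed

lemma tanh_umbral_smult: "tanh_umbral (smult c p) = smult c (tanh_umbral p)"
  by (simp add: tanh_umbral_bound[of _ "degree p"] degree_smult_le coeff_sum sum_distrib_left
      poly_eq_iff mult.assoc)

lemma tanh_umbral_pCons: "tanh_umbral (pCons 0 p) = tanh_op (tanh_umbral p)"
  unfolding tanh_umbral_bound[of "pCons 0 p" "Suc (degree p)", OF degree_pCons_le]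
    sum.atMost_Suc_shift
  by (simp add: tanh_umbral_def tanh_op_sum tanh_op_smult)

lemma tanh_umbral_monom_mult: "tanh_umbral (monom 1 m * p) = (tanh_op ^^ m) (tanh_umbral p)"
  by (induction m) (simp_all add: monom_0 monom_Suc tanh_umbral_pCons)

text \<open>For each real x the generating function L satisfies (1 - t^2) L' = 2 x L; the
  coefficients of t^(n+1) give the recurrence at x, and agreement at every x gives the identity of
  polynomials.\<close>

lemma mittag_leffler_recurrence:
  "smult (real (n + 2)) (mittag_leffler (n + 2)) =
     smult (real n) (mittag_leffler n) + pCons 0 (smult 2 (mittag_leffler (n + 1)))"
proof -
  have "poly (smult (real (n + 2)) (mittag_leffler (n + 2))) x =
     poly (smult (real n) (mittag_leffler n) + pCons 0 (smult 2 (mittag_leffler (n + 1)))) x" for x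
  proof -
    define L where "L = Abs_fps (\<lambda>n. poly (mittag_leffler n) x)"
    have "fps_deriv L = fps_const (2 * x) * L * fps_deriv fps_artanh"
      unfolding L_def mittag_leffler_exp
      by (simp add: fps_compose_deriv fps_artanh_def fps_compose_mult_distrib mult_ac)
    then have "(1 - fps_X ^ 2) * fps_deriv L =
        fps_const (2*x) * L * ((1 - fps_X ^ 2) * fps_deriv fps_artanh)"
      by (simp only: mult_ac)
    then have "(1 - fps_X ^ 2) * fps_deriv L = fps_const (2*x) * L"
      by (simp only: fps_artanh_deriv mult_1_right)
    then have "((1 - fps_X ^ 2) * fps_deriv L) $ (n + 1) = (fps_const (2*x) * L) $ (n + 1)"
      by (rule arg_cong)
    \<comment> \<open>For n = 0 the shifted series t^2 L' has no coefficient at t^1, in agreement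
      with the factor n of \<open>mittag_leffler n\<close>.\<close>
    then show ?thesis
      by (cases n) (simp_all add: L_def left_diff_distrib fps_X_power_mult_nth algebra_simps)
  qed
  then show ?thesis by (simp add: poly_eq_poly_eq_iff[symmetric] fun_eq_iff)
qed

lemma mittag_leffler_1: "mittag_leffler 1 = monom 1 1"
  by (rule poly_eqI)
     (auto simp: coeff_mittag_leffler fps_artanh_def le_Suc_eq)

text \<open>Strong induction, since both sides obey the same three-term recurrence. Solving
  \<open>tanh_op_monom\<close> for its highest monomial and applying \<open>tanh_op\<close> once
  more yields the combination of two earlier cases that \<open>mittag_leffler_recurrence\<close>
  evaluates.\<close>

lemma tanh_op_monom_eq_umbral:
  "tanh_op (monom 1 (Suc n)) = smult (real (Suc n)) (tanh_umbral (mittag_leffler (Suc n)))"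
proof (induction n rule: less_induct)
  case (less n)
  show ?case
  proof (cases n)
    case 0
    then show ?thesis
      using mittag_leffler_1 by (simp add: tanh_umbral_bound[of _ 1] degree_monom_le)
  next
    case (Suc m)
    have shift: "tanh_op (monom 1 m) = smult (real m) (tanh_umbral (mittag_leffler m))"
      using less[of "m - 1"] Suc by (cases m) (auto simp: tanh_op_def pderiv_1)
    have "monom 1 (m + 2) = smult (2 / real (Suc m)) (tanh_op (monom 1 (Suc m))) + monom 1 m"
      unfolding tanh_op_monom smult_smult by (simp add: field_simps del: of_nat_Suc)
    also have "\<dots> = monom 1 m + smult 2 (tanh_umbral (mittag_leffler (Suc m)))"
      using less[of m] Suc by (simp del: of_nat_Suc)
    finally have "tanh_op (monom 1 (m + 2)) =
       smult (real m) (tanh_umbral (mittag_leffler m)) + smult 2 (tanh_op (tanh_umbral (mittag_leffler (Suc m))))"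
      by (simp add: tanh_op_add tanh_op_smult shift)
    also have "\<dots> = tanh_umbral (smult (real (m + 2)) (mittag_leffler (m + 2)))"
      unfolding mittag_leffler_recurrence
      by (simp add: tanh_umbral_add tanh_umbral_pCons tanh_umbral_smult tanh_op_smult)
    finally show ?thesis unfolding tanh_umbral_smult Suc by simp
  qed
qed

subsection \<open>Integrals of the partial fractions\<close>

lemma norm_inverse_add_ii: "norm (inverse (complex_of_real x + \<i>)) ^ 2 = 1 / (1 + x\<^sup>2)"
  unfolding norm_inverse power_inverse cmod_power2 by (simp add: inverse_eq_divide add.commute)

lemma norm_inverse_add_ii_power_le:
  assumes "n \<ge> 2"
  shows "norm (inverse (complex_of_real x + \<i>) ^ n) \<le> 1 / (1 + x\<^sup>2)"
proof -
  let ?w = "inverse (complex_of_real x + \<i>)"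
  have "norm ?w ^ 2 \<le> 1 ^ 2" unfolding norm_inverse_add_ii by (simp add: divide_le_eq add_pos_nonneg)
  then have "norm ?w \<le> 1" by (rule power2_le_imp_le) simp
  then have "norm ?w ^ n \<le> norm ?w ^ 2" by (intro power_decreasing assms) auto
  then show ?thesis unfolding norm_inverse_add_ii norm_power .
qed

lemma of_real_add_ii_nonzero: "complex_of_real x + \<i> \<noteq> 0"
  by (simp add: complex_eq_iff)

text \<open>The integrand is the derivative of the real part of an explicit antiderivative
  \<open>\<Phi>\<close> in powers of w = 1 / (x + i), and this real part tends to 0 at both
  ends.\<close>

lemma has_half_line_integral_Re_inverse_power_aux:
  "has_half_line_integral (\<lambda>x. Re (inverse (of_real x + \<i>) ^ (2 * j + 2) +
      \<i> * inverse (of_real x + \<i>) ^ (2 * j + 3))) 0"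
proof -
  define m where "m = 2 * j + 1"
  define w :: "complex \<Rightarrow> complex" where "w = (\<lambda>z. inverse (z + \<i>))"
  define \<Phi> where "\<Phi> = (\<lambda>z. - (w z ^ m / of_nat m) - \<i> * (w z ^ Suc m / of_nat (Suc m)))"
  have nz: "of_real x + \<i> \<noteq> 0" for x by (rule of_real_add_ii_nonzero)
  have m: "m > 0" by (simp add: m_def)
  have w_power: "((\<lambda>z. w z ^ n / of_nat n) has_field_derivative - (w z ^ Suc n)) (at z)"
    if "z + \<i> \<noteq> 0" "n > 0" for z n
    using that unfolding w_def
    by (auto intro!: derivative_eq_intros simp flip: power_Suc power_Suc2)
       (cases n; simp)
  have deriv: "((\<lambda>x. Re (\<Phi> (of_real x))) has_real_derivative
      Re (w x ^ Suc m + \<i> * w x ^ Suc (Suc m))) (at x)" for x :: real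
  proof -
    have "(\<Phi> has_field_derivative (w x ^ Suc m + \<i> * w x ^ Suc (Suc m))) (at (of_real x))"
      unfolding \<Phi>_def
      using DERIV_diff[OF DERIV_minus[OF w_power[OF nz m, of x]]
          DERIV_cmult[OF w_power[OF nz zero_less_Suc[of m], of x], of \<i>]] by simp
    then have "((\<lambda>x. Re (\<Phi> (of_real x))) has_vector_derivative Re (w x ^ Suc m + \<i> * w x ^ Suc (Suc m))) (at x)"
      by (intro bounded_linear.has_vector_derivative[OF bounded_linear_Re] has_vector_derivative_real_field)
    then show ?thesis
      by (simp add: has_real_derivative_iff_has_vector_derivative)
  qed
  have cont: "continuous_on {0<..} (\<lambda>x. Re (w (complex_of_real x) ^ Suc m + \<i> * w (complex_of_real x) ^ Suc (Suc m)))"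
    unfolding w_def using nz by (intro continuous_intros ballI) auto
  have bound: "\<bar>Re (w x ^ Suc m + \<i> * w x ^ Suc (Suc m))\<bar> \<le> 2 / (1 + x\<^sup>2)" for x :: real
  proof -
    have "\<bar>Re (w x ^ Suc m + \<i> * w x ^ Suc (Suc m))\<bar> \<le> norm (w x ^ Suc m) + norm (\<i> * w x ^ Suc (Suc m))"
      by (rule order_trans[OF abs_Re_le_cmod norm_triangle_ineq])
    also have "\<dots> = norm (w x ^ Suc m) + norm (w x ^ Suc (Suc m))" by (simp add: norm_mult)
    also have "\<dots> \<le> 1 / (1 + x\<^sup>2) + 1 / (1 + x\<^sup>2)"
      unfolding w_def using m by (intro add_mono norm_inverse_add_ii_power_le) auto
    finally show ?thesis by simp
  qed
  have "has_half_line_integral (\<lambda>x. Re (w x ^ Suc m + \<i> * w x ^ Suc (Suc m))) (0 - 0)"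
  proof (rule has_half_line_integral_FTC)
    fix x :: real
    show "((\<lambda>x. Re (\<Phi> (of_real x))) has_real_derivative
        Re (w x ^ Suc m + \<i> * w x ^ Suc (Suc m))) (at x)" by (rule deriv)
  next
    show "continuous_on {0<..} (\<lambda>x. Re (w (complex_of_real x) ^ Suc m + \<i> * w (complex_of_real x) ^ Suc (Suc m)))"
      by (rule cont)
  next
    show "set_integrable lborel {0<..} (\<lambda>x. Re (w (complex_of_real x) ^ Suc m + \<i> * w (complex_of_real x) ^ Suc (Suc m)))"
      by (rule set_integrable_half_line_bound[OF cont bound])
  next
    have cont: "isCont (\<lambda>x. Re (\<Phi> (complex_of_real x))) 0"
      by (rule DERIV_isCont[OF deriv])
    \<comment> \<open>Here w(0) = -i. As m is odd, w(0)^m is imaginary and w(0)^(m+1) is real, so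
      both terms of \<open>\<Phi> 0\<close> are imaginary.\<close>
    have "Re (\<Phi> 0) = 0"
      by (simp add: \<Phi>_def w_def m_def power_add power_mult)
    then show "((\<lambda>x. Re (\<Phi> (complex_of_real x))) \<longlongrightarrow> 0) (at_right 0)"
      using cont by (auto simp: isCont_def intro: filterlim_at_split[THEN iffD1, THEN conjunct2])
  next
    have "filterlim (\<lambda>x. complex_of_real x + \<i>) at_infinity at_top"
      by (rule tendsto_add_filterlim_at_infinity'[OF filterlim_of_real_at_infinity tendsto_const])
    then have "((\<lambda>x. w (complex_of_real x)) \<longlongrightarrow> 0) at_top"
      unfolding w_def by (rule filterlim_compose[OF tendsto_inverse_0])
    then have "((\<lambda>x. Re (\<Phi> (complex_of_real x))) \<longlongrightarrow> Re (- (0 ^ m / of_nat m) - \<i> * (0 ^ Suc m / of_nat (Suc m)))) at_top"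
      unfolding \<Phi>_def using m by (intro tendsto_intros) (auto simp del: of_nat_Suc)
    then show "((\<lambda>x. Re (\<Phi> (complex_of_real x))) \<longlongrightarrow> 0) at_top"
      using m by (simp add: power_0_left)
  qed
  then show ?thesis by (simp add: w_def m_def numeral_3_eq_3)
qed

text \<open>With w = 1 / (x + i), the relation x w = 1 - i w gives w^(2j+3) / x = -w^(2j+1) / x +
  (w^(2j+2) + i w^(2j+3)). The real part of the bracket integrates to 0, so each step only flips the
  sign, starting from the integral of 1 / (1 + x^2).\<close>

lemma has_half_line_integral_Re_inverse_power:
  "has_half_line_integral (\<lambda>x. Re (inverse (of_real x + \<i>) ^ (2 * j + 1)) / x) ((-1) ^ j * pi / 2)"
proof (induction j)
  case 0
  have "Re (inverse (complex_of_real x + \<i>)) / x = 1 / (1 + x\<^sup>2)" if "x > 0" for x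
    using that by (simp add: add.commute)
  then show ?case
    using has_half_line_integral_cong[THEN iffD2, OF _ has_half_line_integral_inverse_1_plus_square]
    by simp
next
  case (Suc j)
  have eq: "Re (inverse (of_real x + \<i>) ^ (2 * Suc j + 1)) / x =
      (-1) * (Re (inverse (of_real x + \<i>) ^ (2 * j + 1)) / x) +
      Re (inverse (of_real x + \<i>) ^ (2 * j + 2) + \<i> * inverse (of_real x + \<i>) ^ (2 * j + 3))"
    if "x > 0" for x
  proof -
    define z :: complex where "z = of_real x"
    define w where "w = inverse (z + \<i>)"
    have "(z + \<i>) * w = 1" unfolding w_def z_def using of_real_add_ii_nonzero by simp
    then have zw: "z * w = 1 - \<i> * w" by (simp add: algebra_simps)
    have "z * (w ^ 2 + \<i> * w ^ 3) = (z * w) * w + \<i> * ((z * w) * w ^ 2)"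
      by (simp add: algebra_simps power2_eq_square power3_eq_cube)
    also have "\<dots> = w + w ^ 3"
      unfolding zw by (simp add: algebra_simps power2_eq_square power3_eq_cube)
    finally have "w ^ 3 = z * (w ^ 2 + \<i> * w ^ 3) - w" by simp
    then have "w ^ (2 * j) * w ^ 3 = w ^ (2 * j) * (z * (w ^ 2 + \<i> * w ^ 3) - w)"
      by (rule arg_cong)
    also have "\<dots> = z * (w ^ (2 * j) * w ^ 2 + \<i> * (w ^ (2 * j) * w ^ 3)) - w ^ (2 * j) * w"
      by (simp only: ring_distribs mult_ac)
    finally have "w ^ (2 * j) * w ^ 3 = z * (w ^ (2 * j) * w ^ 2 + \<i> * (w ^ (2 * j) * w ^ 3)) - w ^ (2 * j) * w" .
    then have *: "w ^ (2 * j + 3) = z * (w ^ (2 * j + 2) + \<i> * w ^ (2 * j + 3)) - w ^ (2 * j + 1)"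
      by (simp only: power_add power_one_right)
    have "Re (w ^ (2 * j + 3)) = x * Re (w ^ (2 * j + 2) + \<i> * w ^ (2 * j + 3)) - Re (w ^ (2 * j + 1))"
      using arg_cong[OF *, of Re] unfolding z_def by (simp only: minus_complex.sel Re_complex_of_real
          Im_complex_of_real times_complex.sel(1)[of "of_real x"] mult_zero_left diff_zero)
    then have "Re (w ^ (2 * j + 3)) / x = (-1) * (Re (w ^ (2 * j + 1)) / x) +
        Re (w ^ (2 * j + 2) + \<i> * w ^ (2 * j + 3))"
      using that by (simp add: field_simps)
    moreover have "2 * Suc j + 1 = 2 * j + 3" by simp
    ultimately show ?thesis unfolding w_def z_def by (simp only:)
  qed
  have "has_half_line_integral (\<lambda>x. (-1) * (Re (inverse (of_real x + \<i>) ^ (2 * j + 1)) / x) +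
      Re (inverse (of_real x + \<i>) ^ (2 * j + 2) + \<i> * inverse (of_real x + \<i>) ^ (2 * j + 3)))
      ((-1) * ((-1) ^ j * pi / 2) + 0)"
    by (intro has_half_line_integral_add has_half_line_integral_mult Suc.IH
        has_half_line_integral_Re_inverse_power_aux)
  then show ?case
    by (subst has_half_line_integral_cong[OF eq]) auto
qed

text \<open>The substitution x = c u produces a factor c, which cancels one of the m + 1 factors 1 /
  c.\<close>

lemma has_half_line_integral_scale_power:
  assumes "has_half_line_integral f I" "c > 0"
  shows "has_half_line_integral (\<lambda>x. (1 / c) ^ Suc m * f (x / c)) ((1 / c) ^ m * I)"
  using has_half_line_integral_mult[OF has_half_line_integral_scale[OF assms], of "(1 / c) ^ Suc m"]
    assms(2) by simp

lemma Re_inverse_power_scale: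
  assumes "c > 0"
  shows "Re (inverse (of_real x + \<i> * of_real c) ^ m) / x =
    (1 / c) ^ Suc m * (Re (inverse (of_real (x / c) + \<i>) ^ m) / (x / c))"
proof -
  have "of_real x + \<i> * of_real c = of_real c * (of_real (x / c) + \<i>)"
    using assms by (simp add: distrib_left mult.commute)
  then have "inverse (of_real x + \<i> * of_real c) ^ m =
      of_real ((1 / c) ^ m) * inverse (of_real (x / c) + \<i>) ^ m"
    by (simp add: power_mult_distrib divide_inverse)
  then have "Re (inverse (of_real x + \<i> * of_real c) ^ m) =
      (1 / c) ^ m * Re (inverse (of_real (x / c) + \<i>) ^ m)"
    by (metis Re_complex_of_real Im_complex_of_real mult_zero_left diff_zero times_complex.sel(1))
  then show ?thesis using assms by simp
qed

text \<open>Up to the factor 2^m these are the odd terms of the zeta series. Grouping that series in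
  pairs and removing the even terms, which sum to 2^(-m) times zeta, leaves the odd ones. As
  \<open>f n\<close> has denominator base n + 1, the odd bases sit at even indices.\<close>

lemma sums_half_integer_powers:
  assumes "m \<ge> 2"
  shows "(\<lambda>k. (1 / (real k + 1 / 2)) ^ m) sums ((2 ^ m - 1) * riemann_zeta (real m))"
proof -
  define f where "f = (\<lambda>n. 1 / real (Suc n) ^ m)"
  define Z where "Z = riemann_zeta (real m)"
  have "summable (\<lambda>n. inverse (real n ^ m))" using assms by (rule inverse_power_summable)
  then have "summable f"
    unfolding f_def inverse_eq_divide by (rule summable_Suc_iff[THEN iffD2])
  moreover have "Z = suminf f"
    unfolding Z_def riemann_zeta_def f_def by (intro suminf_cong) (simp add: powr_realpow del: of_nat_Suc)
  ultimately have f: "f sums Z" by (simp add: summable_sums)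
  have "(\<lambda>n. sum f {n * 2..<n * 2 + 2}) sums Z" by (rule sums_group[OF f]) simp
  moreover have "sum f {n * 2..<n * 2 + 2} = f (n * 2) + f (n * 2 + 1)" for n
    by (simp add: numeral_2_eq_2)
  moreover have "f (n * 2 + 1) = (1 / 2) ^ m * f n" for n
  proof -
    have "real (Suc (n * 2 + 1)) = 2 * real (Suc n)" by simp
    then show ?thesis unfolding f_def by (simp only: power_mult_distrib power_one_over) simp
  qed
  ultimately have "(\<lambda>n. f (n * 2) + (1 / 2) ^ m * f n) sums Z" by simp
  from sums_diff[OF this sums_mult[OF f, of "(1 / 2) ^ m"]]
  have "(\<lambda>n. f (n * 2)) sums (Z - (1 / 2) ^ m * Z)" by simp
  from sums_mult[OF this, of "2 ^ m"]
  have "(\<lambda>n. 2 ^ m * f (n * 2)) sums (2 ^ m * (Z - (1 / 2) ^ m * Z))" .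
  moreover have "2 ^ m * f (n * 2) = (1 / (real n + 1 / 2)) ^ m" for n
  proof -
    have "real (Suc (n * 2)) = 2 * (real n + 1 / 2)" by simp
    then show ?thesis unfolding f_def by (simp only: power_mult_distrib power_one_over) simp
  qed
  moreover have "2 ^ m * (Z - (1 / 2) ^ m * Z) = (2 ^ m - 1) * Z"
    by (simp add: algebra_simps power_one_over)
  ultimately show ?thesis by (simp add: Z_def)
qed

subsection \<open>Derivatives of tanh and the digamma function\<close>

text \<open>Logarithmic derivative of the reflection formula for Gamma: both of its sides are
  differentiated and the common nonzero factor is cancelled.\<close>

lemma Digamma_reflection:
  fixes z :: complex
  assumes "z \<notin> \<int>"
  shows "Digamma z - Digamma (1 - z) = - of_real pi * cot (of_real pi * z)"
proof -
  have z: "z \<notin> \<int>\<^sub>\<le>\<^sub>0" "1 - z \<notin> \<int>\<^sub>\<le>\<^sub>0"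
    using assms nonpos_Ints_Int Ints_diff[of 1 "1 - z"] by auto
  have sin: "sin (of_real pi * z) \<noteq> 0"
    using assms by (auto simp: sin_eq_0 elim: Ints_cases)
  have "((\<lambda>z. Gamma z * Gamma (1 - z)) has_field_derivative
      Gamma z * Gamma (1 - z) * (Digamma z - Digamma (1 - z))) (at z)"
    using z by (auto intro!: derivative_eq_intros simp: algebra_simps)
  moreover have "((\<lambda>z. of_real pi / sin (of_real pi * z)) has_field_derivative
      of_real pi / sin (of_real pi * z) * (- of_real pi * cot (of_real pi * z))) (at z)"
    using sin by (auto intro!: derivative_eq_intros simp: cot_def field_simps)
  ultimately have "Gamma z * Gamma (1 - z) * (Digamma z - Digamma (1 - z)) =
      of_real pi / sin (of_real pi * z) * (- of_real pi * cot (of_real pi * z))"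
    unfolding Gamma_reflection_complex by (rule DERIV_unique)
  moreover have "of_real pi / sin (of_real pi * z) \<noteq> 0" using sin by simp
  ultimately show ?thesis
    unfolding Gamma_reflection_complex by (rule iffD1[OF mult_left_cancel, rotated])
qed

lemma half_add_imaginary_notin_Ints: "1 / 2 + \<i> * of_real y \<notin> \<int>"
proof
  assume "1 / 2 + \<i> * of_real y \<in> \<int>"
  then obtain n where "1 / 2 + \<i> * of_real y = of_int n" by (elim Ints_cases)
  then have "real_of_int (2 * n) = real_of_int 1" by (simp add: complex_eq_iff)
  then have "2 * n = 1" by (simp only: of_int_eq_iff)
  then show False by presburger
qed

text \<open>The \<open>n\<close>-th derivative of \<open>tanh x = tan (\<i> x) / \<i>\<close>, read off from the reflection formula of the
  digamma function at \<open>1/2 + \<i> x / \<pi>\<close>.\<close>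

definition tanh_Polygamma :: "nat \<Rightarrow> real \<Rightarrow> complex" where
  "tanh_Polygamma n x = - (\<i> / of_real pi) *
     ((\<i> / of_real pi) ^ n * Polygamma n (1 / 2 + \<i> * of_real (x / pi)) -
      (- (\<i> / of_real pi)) ^ n * Polygamma n (1 / 2 - \<i> * of_real (x / pi)))"

text \<open>The two Polygamma arguments are z and 1 - z with pi z = i x + pi/2. The quarter-period
  shift turns the cotangent of the reflection formula into -tan(i x) = -i tanh x.\<close>

lemma tanh_Polygamma_0: "tanh_Polygamma 0 x = of_real (tanh x)"
proof -
  define w where "w = \<i> * of_real x"
  define z where "z = 1 / 2 + \<i> * of_real (x / pi)"
  have pz: "of_real pi * z = w + of_real pi / 2"
    by (simp add: z_def w_def field_simps)
  have "Digamma z - Digamma (1 - z) = - of_real pi * cot (of_real pi * z)"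
    unfolding z_def by (rule Digamma_reflection[OF half_add_imaginary_notin_Ints])
  also have "cot (of_real pi * z) = - tan w"
    unfolding pz by (simp add: cot_def tan_def sin_add cos_add)
  also have "tan w = \<i> * of_real (tanh x)"
    unfolding w_def using tanh_conv_tan[of "of_real x"] 
    by (simp add: tanh_def sinh_def cosh_def scaleR_conv_of_real flip: exp_of_real)
  finally have "Digamma z - Digamma (1 - z) = of_real pi * (\<i> * of_real (tanh x))" by simp
  then show ?thesis by (simp add: tanh_Polygamma_def z_def algebra_simps)
qed

lemma tanh_Polygamma_deriv:
  "(tanh_Polygamma n has_vector_derivative tanh_Polygamma (Suc n) x) (at x)"
proof -
  define c where "c = \<i> / of_real pi"
  have "c * of_real x = \<i> * of_real (x / pi)" by (simp add: c_def)
  then have nz: "1 / 2 + c * of_real x \<notin> \<int>\<^sub>\<le>\<^sub>0" "1 / 2 - c * of_real x \<notin> \<int>\<^sub>\<le>\<^sub>0"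
    using half_add_imaginary_notin_Ints[of "x / pi"] half_add_imaginary_notin_Ints[of "- (x / pi)"]
      nonpos_Ints_Int by (simp only: of_real_minus mult_minus_right add_uminus_conv_diff; blast)+
  have eq: "tanh_Polygamma n = (\<lambda>x. - c * (c ^ n * Polygamma n (1 / 2 + c * of_real x) -
      (- c) ^ n * Polygamma n (1 / 2 - c * of_real x)))" for n
    by (simp add: tanh_Polygamma_def c_def fun_eq_iff)
  show ?thesis unfolding eq
    by (rule has_vector_derivative_real_field)
       (use nz in \<open>auto intro!: derivative_eq_intros simp: algebra_simps\<close>)
qed

text \<open>Both sides are the n-th derivative of tanh, so equality passes from n to n + 1 by
  uniqueness of derivatives; the factor (-2)^n undoes the normalisation of
  \<open>tanh_op\<close>.\<close>

lemma poly_tanh_op_eq_Polygamma: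
  "of_real ((-2) ^ n * poly ((tanh_op ^^ n) (monom 1 1)) (tanh x)) = tanh_Polygamma n x"
proof (induction n arbitrary: x)
  case 0
  then show ?case by (simp add: tanh_Polygamma_0 poly_monom)
next
  case (Suc n)
  let ?f = "\<lambda>n x. (-2) ^ n * poly ((tanh_op ^^ n) (monom 1 1)) (tanh x)"
  have "((\<lambda>x. of_real (?f n x) :: complex) has_vector_derivative of_real (?f (Suc n) x)) (at x)"
    using DERIV_cmult[OF DERIV_poly_tanh, of "(-2) ^ n" "(tanh_op ^^ n) (monom 1 1)" x]
    by (intro has_vector_derivative_of_real) (simp add: mult_ac)
  moreover have "((\<lambda>x. of_real (?f n x)) has_vector_derivative tanh_Polygamma (Suc n) x) (at x)"
    unfolding Suc.IH by (rule tanh_Polygamma_deriv)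
  ultimately show ?case by (rule vector_derivative_unique_at)
qed

text \<open>Put w = x + i pi (k + 1/2). Pulling out c = i / pi makes the k-th denominators of the
  two Polygamma series powers of c times the conjugate of w and of -c times w. The powers of c
  cancel, and for even n the signs combine so that the two terms add up to twice a real part. For n
  > 0 the exponent n + 1 makes each series converge separately.\<close>

lemma tanh_Polygamma_sums:
  assumes "even n" "n > 0"
  shows "(\<lambda>k. complex_of_real (2 * fact n * Re (inverse (of_real x + \<i> * of_real (pi * (real k + 1 / 2))) ^ Suc n)))
    sums tanh_Polygamma n x"
proof -
  define c where "c = \<i> / of_real pi"
  have sums: "(\<lambda>k. (-1) ^ Suc n * fact n * inverse ((z + of_nat k) ^ Suc n)) sums Polygamma n z"
    if "z \<noteq> 0" for z :: complex
    using sums_mult[OF summable_sums[OF Polygamma_converges'[OF that, of "Suc n"]], of "(-1) ^ Suc n * fact n"]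
      assms(2) by (simp add: Polygamma_def)
  have nz: "1 / 2 + c * of_real x \<noteq> 0" "1 / 2 - c * of_real x \<noteq> 0"
    by (simp_all add: complex_eq_iff c_def)
  have "(\<lambda>k. - c * (c ^ n * ((-1) ^ Suc n * fact n * inverse ((1 / 2 + c * of_real x + of_nat k) ^ Suc n)) -
      (- c) ^ n * ((-1) ^ Suc n * fact n * inverse ((1 / 2 - c * of_real x + of_nat k) ^ Suc n))))
     sums (- c * (c ^ n * Polygamma n (1 / 2 + c * of_real x) -
      (- c) ^ n * Polygamma n (1 / 2 - c * of_real x)))"
    by (intro sums_mult sums_diff sums nz)
  moreover have "- c * (c ^ n * ((-1) ^ Suc n * fact n * inverse ((1 / 2 + c * of_real x + of_nat k) ^ Suc n)) -
      (- c) ^ n * ((-1) ^ Suc n * fact n * inverse ((1 / 2 - c * of_real x + of_nat k) ^ Suc n))) =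
    of_real (2 * fact n * Re (inverse (of_real x + \<i> * of_real (pi * (real k + 1 / 2))) ^ Suc n))" for k
  proof -
    define \<alpha> where "\<alpha> = pi * (real k + 1 / 2)"
    define w where "w = of_real x + \<i> * of_real \<alpha>"
    have c: "c \<noteq> 0" by (simp add: c_def)
    have 1: "1 / 2 + c * of_real x + of_nat k = c * cnj w"
      by (simp add: c_def w_def \<alpha>_def field_simps)
    have 2: "1 / 2 - c * of_real x + of_nat k = (- c) * w"
      by (simp add: c_def w_def \<alpha>_def field_simps)
    have inv: "c * (c ^ n * inverse (c ^ Suc n)) = 1"
      unfolding mult.assoc[symmetric] power_Suc[symmetric] using c by (intro right_inverse) simp
    have "- c * (c ^ n * ((-1) ^ Suc n * fact n * inverse ((c * cnj w) ^ Suc n)) -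
        (- c) ^ n * ((-1) ^ Suc n * fact n * inverse (((- c) * w) ^ Suc n))) =
       fact n * (c * (c ^ n * inverse (c ^ Suc n))) * (inverse (cnj w) ^ Suc n + inverse w ^ Suc n)"
      using assms(1) by (simp add: power_mult_distrib algebra_simps power_inverse)
    also have "inverse (cnj w) ^ Suc n + inverse w ^ Suc n = of_real (2 * Re (inverse w ^ Suc n))"
      using complex_add_cnj[of "inverse w ^ Suc n"] by (simp add: add.commute)
    finally show ?thesis unfolding inv 1 2 by (simp add: w_def \<alpha>_def mult_ac)
  qed
  ultimately show ?thesis by (simp add: tanh_Polygamma_def c_def)
qed

section \<open>Termwise integration of the derivatives of tanh against 1 / x\<close>

lemma poly_tanh_op_sums:
  assumes "even n" "n > 0"
  shows "(\<lambda>k. fact n / 2 ^ (n - 1) * Re (inverse (of_real x + \<i> * of_real (pi * (real k + 1 / 2))) ^ Suc n))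
    sums poly ((tanh_op ^^ n) (monom 1 1)) (tanh x)"
proof -
  have "(\<lambda>k. 2 * fact n * Re (inverse (of_real x + \<i> * of_real (pi * (real k + 1 / 2))) ^ Suc n))
    sums ((-2) ^ n * poly ((tanh_op ^^ n) (monom 1 1)) (tanh x))"
    using tanh_Polygamma_sums[OF assms, of x] unfolding poly_tanh_op_eq_Polygamma[symmetric] sums_of_real_iff .
  from sums_mult[OF this, of "1 / 2 ^ n"]
  have "(\<lambda>k. 1 / 2 ^ n * (2 * fact n * Re (inverse (of_real x + \<i> * of_real (pi * (real k + 1 / 2))) ^ Suc n)))
    sums poly ((tanh_op ^^ n) (monom 1 1)) (tanh x)"
    using assms(1) by simp
  moreover have "1 / 2 ^ n * (2 * fact n * y) = fact n / 2 ^ (n - 1) * y" for y :: real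
    using assms(2) by (cases n) simp_all
  ultimately show ?thesis by simp
qed

text \<open>Every partial fraction is a rescaled copy of one function g, so the k-th integral and
  the k-th L1 norm are those of g times D / c_k^m. Since m is at least 3, the norms are summable,
  and the integrals add up to a zeta value.\<close>

lemma has_half_line_integral_poly_tanh_op:
  assumes "j > 0"
  shows "has_half_line_integral (\<lambda>x. poly ((tanh_op ^^ (2 * j)) (monom 1 1)) (tanh x) / x)
    (umbral_h (2 * j + 1))"
proof -
  define m where "m = 2 * j + 1"
  define D :: real where "D = fact (2 * j) / 2 ^ (2 * j - 1)"
  define c where "c = (\<lambda>k. pi * (real k + 1 / 2))"
  define g where "g = (\<lambda>x. Re (inverse (of_real x + \<i>) ^ m) / x)"
  define f where "f = (\<lambda>k x. D * ((1 / c k) ^ Suc m * g (x / c k)))"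
  have c: "c k > 0" for k by (simp add: c_def add_nonneg_pos)
  have D: "D > 0" by (simp add: D_def)
  have g: "has_half_line_integral g ((-1) ^ j * pi / 2)"
    unfolding g_def m_def by (rule has_half_line_integral_Re_inverse_power)
  obtain N where N: "has_half_line_integral (\<lambda>x. \<bar>g x\<bar>) N"
    using has_half_line_integral_abs[OF g] .
  have f_eq: "f k x = D * Re (inverse (of_real x + \<i> * of_real (c k)) ^ m) / x" for k x
  proof -
    have "f k x = D * (Re (inverse (of_real x + \<i> * of_real (c k)) ^ m) / x)"
      unfolding Re_inverse_power_scale[OF c] f_def g_def ..
    then show ?thesis by simp
  qed
  have powers: "(\<lambda>k. (1 / c k) ^ m) sums ((1 / pi) ^ m * ((2 ^ m - 1) * riemann_zeta (real m)))"
  proof -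
    have "(1 / c k) ^ m = (1 / pi) ^ m * (1 / (real k + 1 / 2)) ^ m" for k
      by (simp add: c_def flip: power_mult_distrib)
    then show ?thesis
      using sums_mult[OF sums_half_integer_powers[of m], of "(1 / pi) ^ m"] assms
      by (simp only: m_def)
  qed
  have "has_half_line_integral (\<lambda>x. poly ((tanh_op ^^ (2 * j)) (monom 1 1)) (tanh x) / x)
     (D * ((1 / pi) ^ m * ((2 ^ m - 1) * riemann_zeta (real m)) * ((-1) ^ j * pi / 2)))"
  proof (rule has_half_line_integral_sums)
    fix k
    show "has_half_line_integral (f k) (D * ((1 / c k) ^ m * ((-1) ^ j * pi / 2)))"
      unfolding f_def by (intro has_half_line_integral_mult has_half_line_integral_scale_power g c)
    have "\<bar>f k x\<bar> = D * ((1 / c k) ^ Suc m * \<bar>g (x / c k)\<bar>)" for x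
      using D c[of k] by (simp add: f_def abs_mult power_abs)
    then show "has_half_line_integral (\<lambda>x. \<bar>f k x\<bar>) (D * ((1 / c k) ^ m * N))"
      using has_half_line_integral_mult[OF has_half_line_integral_scale_power[OF N c]] by simp
  next
    show "summable (\<lambda>k. D * ((1 / c k) ^ m * N))"
      by (intro summable_mult summable_mult2 sums_summable[OF powers])
    show "(\<lambda>k. D * ((1 / c k) ^ m * ((-1) ^ j * pi / 2))) sums
        (D * ((1 / pi) ^ m * ((2 ^ m - 1) * riemann_zeta (real m)) * ((-1) ^ j * pi / 2)))"
      by (intro sums_mult sums_mult2 powers)
  next
    fix x :: real assume x: "x > 0"
    show "summable (\<lambda>k. \<bar>f k x\<bar>)"
    proof (rule summable_comparison_test[OF exI, OF allI, OF impI])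
      show "summable (\<lambda>k. D / x * (1 / c k) ^ m)"
        by (intro summable_mult sums_summable[OF powers])
      fix k :: nat
      \<comment> \<open>The modulus of x + i c_k is at least its imaginary part, which bounds the
        terms uniformly in x.\<close>
      have "norm (inverse (of_real x + \<i> * of_real (c k))) \<le> 1 / c k"
        using abs_Im_le_cmod[of "of_real x + \<i> * of_real (c k)"] c[of k]
        unfolding norm_inverse inverse_eq_divide[symmetric] by (intro le_imp_inverse_le) auto
      then have "norm (inverse (of_real x + \<i> * of_real (c k)) ^ m) \<le> (1 / c k) ^ m"
        unfolding norm_power by (intro power_mono) auto
      then have "\<bar>Re (inverse (of_real x + \<i> * of_real (c k)) ^ m)\<bar> \<le> (1 / c k) ^ m"
        using abs_Re_le_cmod order_trans by blast
      then have "D / x * \<bar>Re (inverse (of_real x + \<i> * of_real (c k)) ^ m)\<bar> \<le> D / x * (1 / c k) ^ m"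
        using D x by (intro mult_left_mono) auto
      then show "norm \<bar>f k x\<bar> \<le> D / x * (1 / c k) ^ m"
        using D x unfolding f_eq by (simp add: abs_mult)
    qed
    have "(\<lambda>k. D * Re (inverse (of_real x + \<i> * of_real (c k)) ^ m)) sums
        poly ((tanh_op ^^ (2 * j)) (monom 1 1)) (tanh x)"
      using poly_tanh_op_sums[of "2 * j" x] assms by (simp add: D_def c_def m_def)
    then show "(\<lambda>k. f k x) sums (poly ((tanh_op ^^ (2 * j)) (monom 1 1)) (tanh x) / x)"
      unfolding f_eq by (rule sums_divide)
  qed
  \<comment> \<open>For j > 0 the truncated exponent 2 j - 1 is genuine; the factor 2 gained here
    cancels the half in pi / 2.\<close>
  moreover have D_eq: "D = 2 * fact (2 * j) / 2 ^ (2 * j)"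
    using assms by (cases j) (simp_all add: D_def)
  have "D * ((1 / pi) ^ m * ((2 ^ m - 1) * riemann_zeta (real m)) * ((-1) ^ j * pi / 2)) =
      umbral_h (2 * j + 1)"
    unfolding D_eq umbral_h_def m_def by (simp add: power_one_over)
  ultimately show ?thesis by (simp only:)
qed

text \<open>Integration against 1 / x supplies one factor h: the r-th power of -D/2 applied to tanh
  yields h_(r+1). Membership in \<open>umbral_domain\<close> leaves only even r with r at least 2,
  which excludes the divergent integral of tanh x / x.\<close>

lemma has_half_line_integral_tanh_umbral:
  assumes "pCons 0 q \<in> umbral_domain"
  shows "has_half_line_integral (\<lambda>x. poly (tanh_umbral q) (tanh x) / x) (umbral_eval (pCons 0 q))"
proof -
  have "has_half_line_integral
      (\<lambda>x. coeff q r * (poly ((tanh_op ^^ r) (monom 1 1)) (tanh x) / x)) (coeff q r * umbral_h (Suc r))" for r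
  proof (cases "coeff q r = 0")
    case True
    then show ?thesis
      by (simp add: has_half_line_integral_def has_bochner_integral_zero)
  next
    case False
    then have "coeff (pCons 0 q) (Suc r) \<noteq> 0" by simp
    then have "odd (Suc r)" "Suc r \<ge> 3" using assms by (auto simp: umbral_domain_def simp del: coeff_pCons_Suc)
    then obtain j where "r = 2 * j" "j > 0" by (auto elim!: evenE)
    then show ?thesis using has_half_line_integral_poly_tanh_op[of j]
      by (intro has_half_line_integral_mult) simp
  qed
  then have "has_half_line_integral
      (\<lambda>x. \<Sum>r\<le>degree q. coeff q r * (poly ((tanh_op ^^ r) (monom 1 1)) (tanh x) / x))
      (\<Sum>r\<le>degree q. coeff q r * umbral_h (Suc r))"
    by (intro has_half_line_integral_sum)
  moreover have "(\<Sum>r\<le>degree q. coeff q r * umbral_h (Suc r)) = umbral_eval (pCons 0 q)"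
    unfolding umbral_eval_bound[of "pCons 0 q" "Suc (degree q)", OF degree_pCons_le]
      sum.atMost_Suc_shift by simp
  ultimately show ?thesis
    by (simp add: tanh_umbral_def poly_sum sum_divide_distrib)
qed

subsection \<open>Integration by parts\<close>

lemma tanh_real_le_self:
  assumes "x \<ge> 0"
  shows "tanh x \<le> (x :: real)"
proof -
  have "0 - tanh 0 \<le> x - tanh x"
    by (rule DERIV_nonneg_imp_nondecreasing[OF assms])
       (auto intro!: derivative_eq_intros exI simp: cosh_real_nonzero)
  then show ?thesis by simp
qed

text \<open>\<open>?G\<close> is the derivative of -f / (m x^m). The bound by tanh^(m+1) makes this
  boundary function O(tanh x) at 0 and O(1/x) at infinity, so \<open>?G\<close> integrates to
  0.\<close>

lemma has_half_line_integral_by_parts: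
  assumes deriv: "\<And>x. x > 0 \<Longrightarrow> (f has_real_derivative f' x) (at x)"
    and cont: "continuous_on {0<..} f'"
    and bound: "\<And>x. x > 0 \<Longrightarrow> \<bar>f x\<bar> \<le> C * tanh x ^ (m + 1)"
    and m: "m > 0" and int: "has_half_line_integral (\<lambda>x. f' x / x ^ m) I"
  shows "has_half_line_integral (\<lambda>x. f x / x ^ (m + 1)) (I / real m)"
proof -
  let ?G = "\<lambda>x. f x / x ^ (m + 1) + (-1 / real m) * (f' x / x ^ m)"
  have f: "continuous_on {0<..} f"
    using deriv by (auto intro!: continuous_at_imp_continuous_on DERIV_isCont)
  have C: "C \<ge> 0"
  proof (rule ccontr)
    assume "\<not> C \<ge> 0"
    moreover have "tanh (1::real) ^ (m + 1) > 0" by (rule zero_less_power) simp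
    ultimately have "C * tanh 1 ^ (m + 1) < 0" by (intro mult_neg_pos) auto
    then show False using bound[of 1] by linarith
  qed
  have "set_integrable lborel {0<..} (\<lambda>x. f x / x ^ (m + 1))"
  proof (rule set_integrable_half_line_bound)
    show "continuous_on {0<..} (\<lambda>x. f x / x ^ (m + 1))"
      using f by (intro continuous_intros) auto
    fix x :: real assume x: "x > 0"
    define q where "q = tanh x / x"
    have q: "0 \<le> q" "q \<le> 1" using tanh_real_le_self[of x] x by (auto simp: q_def)
    \<comment> \<open>Sum of the estimates q^2 \<le> 1, effective near 0, and x^2 q^2 \<le> 1,
      effective at infinity.\<close>
    have q2: "q ^ 2 \<le> 2 / (1 + x\<^sup>2)"
    proof -
      have "(tanh x)\<^sup>2 \<le> 1\<^sup>2" using tanh_real_lt_1[of x] x by (intro power_mono) auto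
      then have "x\<^sup>2 * q\<^sup>2 \<le> 1" using x by (simp add: q_def power_divide)
      moreover have "q\<^sup>2 \<le> 1" using q by (simp add: power_le_one)
      ultimately have "q\<^sup>2 * (1 + x\<^sup>2) \<le> 2" by (simp add: algebra_simps)
      then show ?thesis by (simp add: pos_le_divide_eq add_pos_nonneg)
    qed
    have "\<bar>f x / x ^ (m + 1)\<bar> \<le> C * q ^ (m + 1)"
      using bound[OF x] x by (simp add: abs_mult q_def power_divide divide_right_mono)
    also have "\<dots> \<le> C * q ^ 2"
      using q m C by (intro mult_left_mono power_decreasing) auto
    also have "\<dots> \<le> C * (2 / (1 + x\<^sup>2))" by (rule mult_left_mono[OF q2 C])
    finally show "\<bar>f x / x ^ (m + 1)\<bar> \<le> (C * 2) / (1 + x\<^sup>2)" by simp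
  qed
  then have G_int: "set_integrable lborel {0<..} ?G"
    using int by (intro set_integral_add set_integrable_mult_right) (auto simp: has_half_line_integral_iff)
  have small: "\<bar>- f x / (real m * x ^ m)\<bar> \<le> C / real m * (tanh x * (tanh x / x) ^ m)" if x: "x > 0" for x
  proof -
    have "\<bar>- f x / (real m * x ^ m)\<bar> = \<bar>f x\<bar> / (real m * x ^ m)" using x by (simp add: abs_mult)
    also have "\<dots> \<le> C * tanh x ^ (m + 1) / (real m * x ^ m)"
      using x bound[OF x] by (intro divide_right_mono) auto
    finally show ?thesis by (simp add: power_divide)
  qed
  have "has_half_line_integral ?G (0 - 0)"
  proof (rule has_half_line_integral_FTC[OF _ _ G_int])
    fix x :: real assume x: "x > 0"
    show "((\<lambda>x. - f x / (real m * x ^ m)) has_real_derivative ?G x) (at x)"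
    proof -
      define M y where "M = real m" and "y = x ^ (m - 1)"
      have nz: "M \<noteq> 0" "y \<noteq> 0" "x \<noteq> 0" using m x by (simp_all add: M_def y_def)
      have xm: "x ^ m = x * y" using m by (cases m) (simp_all add: y_def)
      have "((\<lambda>x. x ^ m) has_real_derivative M * y) (at x)"
        using DERIV_pow[of m x] by (simp add: M_def y_def)
      from DERIV_cmult[OF DERIV_divide[OF deriv[OF x] this], of "-1 / M"]
      have "((\<lambda>x. -1 / M * (f x / x ^ m)) has_real_derivative
          -1 / M * ((f' x * x ^ m - f x * (M * y)) / (x ^ m * x ^ m))) (at x)"
        using x by simp
      moreover have "-1 / M * ((f' x * x ^ m - f x * (M * y)) / (x ^ m * x ^ m)) = ?G x"
        unfolding M_def[symmetric] power_add xm using nz by (simp add: field_simps)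
      moreover have "(\<lambda>x. -1 / M * (f x / x ^ m)) = (\<lambda>x. - f x / (real m * x ^ m))"
        by (simp add: fun_eq_iff M_def)
      ultimately show ?thesis by simp
    qed
  next
    show "continuous_on {0<..} ?G" using f cont by (intro continuous_intros) auto
  next
    show "((\<lambda>x. - f x / (real m * x ^ m)) \<longlongrightarrow> 0) (at_right 0)"
    proof (rule Lim_null_comparison)
      show "\<forall>\<^sub>F x in at_right 0. norm (- f x / (real m * x ^ m)) \<le> C / real m * tanh x"
      proof (rule eventually_at_right_less[THEN eventually_mono])
        fix x :: real assume x: "0 < x"
        have "(tanh x / x) ^ m \<le> 1"
          using tanh_real_le_self[of x] x by (intro power_le_one) auto
        then have "C / real m * (tanh x * (tanh x / x) ^ m) \<le> C / real m * (tanh x * 1)"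
          using C x by (intro mult_left_mono) auto
        then show "norm (- f x / (real m * x ^ m)) \<le> C / real m * tanh x"
          using small[OF x] by simp
      qed
      have "((\<lambda>x. C / real m * tanh x) \<longlongrightarrow> C / real m * tanh 0) (at_right 0)"
        by (intro tendsto_intros) (simp add: cosh_real_nonzero)
      then show "((\<lambda>x. C / real m * tanh x) \<longlongrightarrow> 0) (at_right 0)" by simp
    qed
  next
    show "((\<lambda>x. - f x / (real m * x ^ m)) \<longlongrightarrow> 0) at_top"
    proof (rule Lim_null_comparison)
      show "\<forall>\<^sub>F x in at_top. norm (- f x / (real m * x ^ m)) \<le> C / real m * (1 / x)"
      proof (rule eventually_gt_at_top[of 0, THEN eventually_mono])
        fix x :: real assume x: "0 < x"
        have "(tanh x / x) ^ m \<le> (tanh x / x) ^ 1"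
          using tanh_real_le_self[of x] x m by (intro power_decreasing) auto
        also have "\<dots> \<le> 1 / x" using x tanh_real_lt_1[of x] by (simp add: divide_right_mono)
        finally have "tanh x * (tanh x / x) ^ m \<le> 1 * (1 / x)"
          using x tanh_real_lt_1[of x] by (intro mult_mono) auto
        then have "C / real m * (tanh x * (tanh x / x) ^ m) \<le> C / real m * (1 / x)"
          using C by (intro mult_left_mono) auto
        then show "norm (- f x / (real m * x ^ m)) \<le> C / real m * (1 / x)"
          using small[OF x] by simp
      qed
      have "((\<lambda>x. C / real m * (1 / x)) \<longlongrightarrow> C / real m * 0) at_top"
        by (intro tendsto_mult_left tendsto_divide_0[OF tendsto_const] filterlim_at_top_imp_at_infinity filterlim_ident)
      then show "((\<lambda>x. C / real m * (1 / x)) \<longlongrightarrow> 0) at_top" by simp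
    qed
  qed
  from has_half_line_integral_add[OF this has_half_line_integral_mult[OF int, of "1 / real m"]]
  show ?thesis by simp
qed

text \<open>The cofactor is bounded on the compact interval [0, 1], which contains tanh x for all x
  > 0.\<close>

lemma monom_dvd_imp_poly_bound:
  fixes p :: "real poly"
  assumes "monom 1 n dvd p"
  shows "\<exists>C. \<forall>t\<in>{0..1}. \<bar>poly p t\<bar> \<le> C * t ^ n"
proof -
  obtain q where q: "p = monom 1 n * q" using assms by (elim dvdE)
  have "bounded (poly q ` {0..1})"
    by (intro compact_imp_bounded compact_continuous_image continuous_intros) auto
  then obtain C where C: "\<forall>t\<in>{0..1}. \<bar>poly q t\<bar> \<le> C"
    by (auto simp: bounded_iff)
  have "\<bar>poly p t\<bar> \<le> C * t ^ n" if t: "t \<in> {0..1}" for t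
    using mult_right_mono[of "\<bar>poly q t\<bar>" C "t ^ n"] C t
    by (simp add: q poly_monom abs_mult mult.commute)
  then show ?thesis by blast
qed

lemma monom_dvd_monom:
  assumes "i \<le> j"
  shows "monom 1 i dvd (monom 1 j :: 'a :: comm_semiring_1 poly)"
  using assms by (intro dvdI[of _ _ "monom 1 (j - i)"]) (simp add: mult_monom)

text \<open>The induction runs backwards from b - 1 derivatives over x: each integration by parts
  removes one derivative, adds one power of x to the denominator and contributes a factor -2 / (k +
  1).\<close>

lemma has_half_line_integral_tanh_power:
  assumes ab: "a \<ge> b" "b > 0"
    and V: "has_half_line_integral (\<lambda>x. poly ((tanh_op ^^ (b - 1)) (monom 1 a)) (tanh x) / x) V"
  shows "has_half_line_integral (\<lambda>x. tanh x ^ a / x ^ b) ((-2) ^ (b - 1) / fact (b - 1) * V)"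
proof -
  have "has_half_line_integral
      (\<lambda>x. poly ((tanh_op ^^ (b - Suc k)) (monom 1 a)) (tanh x) / x ^ Suc k) ((-2) ^ k / fact k * V)"
    if "k < b" for k
    using that
  proof (induction k)
    case 0
    then show ?case using V by simp
  next
    case (Suc k)
    define p where "p = (tanh_op ^^ (b - Suc (Suc k))) (monom 1 a)"
    have "b - Suc k = Suc (b - Suc (Suc k))" using Suc.prems by simp
    then have p: "(tanh_op ^^ (b - Suc k)) (monom 1 a) = tanh_op p" by (simp add: p_def)
    have IH: "has_half_line_integral (\<lambda>x. poly (tanh_op p) (tanh x) / x ^ Suc k) ((-2) ^ k / fact k * V)"
      using Suc unfolding p by simp
    have "monom 1 (a - (b - Suc (Suc k))) dvd p"
      unfolding p_def by (rule monom_dvd_funpow_tanh_op)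
    \<comment> \<open>This is where a \<ge> b enters: after b - k - 2 derivatives t^a still vanishes
      to order at least k + 2, as the boundary estimate requires.\<close>
    moreover have "monom 1 (Suc (Suc k)) dvd (monom 1 (a - (b - Suc (Suc k))) :: real poly)"
      using ab Suc.prems by (intro monom_dvd_monom) simp
    ultimately have "monom 1 (Suc (Suc k)) dvd p" by (rule dvd_trans[rotated])
    then obtain C where C: "\<forall>t\<in>{0..1}. \<bar>poly p t\<bar> \<le> C * t ^ Suc (Suc k)"
      using monom_dvd_imp_poly_bound by blast
    have "has_half_line_integral (\<lambda>x. poly p (tanh x) / x ^ (Suc k + 1))
        (-2 * ((-2) ^ k / fact k * V) / real (Suc k))"
    proof (rule has_half_line_integral_by_parts)
      show "((\<lambda>x. poly p (tanh x)) has_real_derivative -2 * poly (tanh_op p) (tanh x)) (at x)" for x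
        by (rule DERIV_poly_tanh)
      show "continuous_on {0<..} (\<lambda>x::real. -2 * poly (tanh_op p) (tanh x))"
        by (intro continuous_intros) (auto simp: cosh_real_nonzero)
      show "\<bar>poly p (tanh x)\<bar> \<le> C * tanh x ^ (Suc k + 1)" if "x > 0" for x
        using C[rule_format, of "tanh x"] that tanh_real_lt_1[of x] by simp
      show "has_half_line_integral (\<lambda>x. -2 * poly (tanh_op p) (tanh x) / x ^ Suc k)
          (-2 * ((-2) ^ k / fact k * V))"
        using has_half_line_integral_mult[OF IH, of "-2"] by simp
    qed simp
    then show ?case by (simp add: p_def mult_ac)
  qed
  from this[of "b - 1"] show ?thesis using ab by (simp add: poly_monom)
qed

section \<open>Reduction of the integral to the umbral evaluation\<close>

theorem theorem5p1:
  fixes a b :: nat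
  assumes "a \<ge> b" and "b \<ge> 2" and "a mod 2 = b mod 2"
  shows "((\<lambda>x::real. tanh x ^ a / x ^ b) has_integral
          (real a * 2 ^ (b - 1) / fact (b - 1)) *
            umbral_eval ((- [:0, 1:]) ^ (b - 1) * mittag_leffler a)) {0<..}"
proof -
  \<comment> \<open>The b - 1 = c + 1 derivatives split: one turns t^a into a g_a(h) applied to
    tanh, the other c contribute h^c. The remaining factor h of h^(b-1) comes from integrating
    against 1 / x, hence the form \<open>pCons 0 q\<close>.\<close>
  obtain c where b: "b = Suc (Suc c)" using assms(2) by (metis add_2_eq_Suc le_Suc_ex)
  obtain a' where a: "a = Suc a'" using assms(1) b by (cases a) auto
  define q where "q = monom 1 c * mittag_leffler a"
  have q: "monom 1 (b - 1) * mittag_leffler a = pCons 0 q"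
    unfolding b q_def by (simp add: monom_Suc)
  have "pCons 0 q \<in> umbral_domain"
  proof -
    have "smult ((-1) ^ (b - 1)) (pCons 0 q) \<in> umbral_domain"
      using umbral_argument_in_domain[OF assms] unfolding umbral_argument_eq q .
    moreover have "(-1) ^ (b - 1) \<noteq> (0 :: real)" by simp
    ultimately show ?thesis
      unfolding umbral_domain_def mem_Collect_eq coeff_smult mult_eq_0_iff by blast
  qed
  then have "has_half_line_integral (\<lambda>x. real a * (poly (tanh_umbral q) (tanh x) / x))
      (real a * umbral_eval (pCons 0 q))"
    by (intro has_half_line_integral_mult has_half_line_integral_tanh_umbral)
  then have "has_half_line_integral
      (\<lambda>x. poly (smult (real a) (tanh_umbral q)) (tanh x) / x) (real a * umbral_eval (pCons 0 q))"
    by simp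
  moreover have "(tanh_op ^^ (b - 1)) (monom 1 a) = smult (real a) (tanh_umbral q)"
  proof -
    have "(tanh_op ^^ (b - 1)) (monom 1 a) = (tanh_op ^^ c) (tanh_op (monom 1 a))"
      by (simp add: b funpow_swap1)
    also have "\<dots> = smult (real a) (tanh_umbral q)"
      unfolding a q_def tanh_op_monom_eq_umbral funpow_tanh_op_smult tanh_umbral_monom_mult ..
    finally show ?thesis .
  qed
  ultimately have "has_half_line_integral (\<lambda>x. tanh x ^ a / x ^ b)
      ((-2) ^ (b - 1) / fact (b - 1) * (real a * umbral_eval (pCons 0 q)))"
    using assms(1,2) by (intro has_half_line_integral_tanh_power) simp_all
  \<comment> \<open>The sign of (-2)^(b-1) is the one carried by the power (-h)^(b-1).\<close>
  moreover have "(-2) ^ (b - 1) / fact (b - 1) * (real a * umbral_eval (pCons 0 q)) =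
      (real a * 2 ^ (b - 1) / fact (b - 1)) * umbral_eval ((- [:0, 1:]) ^ (b - 1) * mittag_leffler a)"
    unfolding umbral_argument_eq q umbral_eval_smult
    by (subst power_minus) simp
  ultimately show ?thesis
    using has_half_line_integral_imp_has_integral by metis
qed

end
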